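(* Let $n\ge2$ and let $A_1,\dots,A_m\in\mathbb{S}^n$ satisfy $\operatorname{tr}A_i=0$ and $\operatorname{tr}(A_iA_j)=\delta_{ij}$ for all $i,j=1,\dots,m$. Let $\mathbf{b}\in\mathbb{R}^m$ and $f(\mathbf{y})=\log\operatorname{tr}\exp A(\mathbf{y})-\mathbf{b}^T\mathbf{y}$. Then $\mathbf{b}\in\mathscr{M}$ if and only if $f(\mathbf{y})\ge0$ for all $\mathbf{y}\in\mathbb{R}^m$. Consequently, if $(\mathbf{y}_k)_{k\ge 0}$ is a sequence generated by the gradient method $\mathbf{y}_{k+1}=\mathbf{y}_k-2\nabla f(\mathbf{y}_k)$ and $f(\mathbf{y}_k)<0$ at some iterate $\mathbf{y}_k$, then $\mathbf{b}\notin\mathscr{M}$, and $\mathbf{v}:=\mathbf{y}_k$ separates $\mathbf{b}$ from $\mathscr{M}$, namely $\lambda_{\max}(A(\mathbf{v}))<\mathbf{b}^T\mathbf{v}$.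
   Context: $\mathbb{S}^n$ is the space of real symmetric $n\times n$ matrices, and $\mathbb{S}^n_1=\{X\in\mathbb{S}^n: X\succeq 0,\ \operatorname{tr}X=1\}$. $\delta_{ij}$ equals $1$ if $i=j$ and $0$ otherwise. $A(\mathbf{y})=\sum_{i=1}^m y_iA_i$, $\mathcal{A}(X)=(\operatorname{tr}(A_iX))_{i=1,\dots,m}$, and the moment body is $\mathscr{M}=\mathcal{A}(\mathbb{S}^n_1)\subset\mathbb{R}^m$, whose support function is $\max_{\mathbf{z}\in\mathscr{M}}\mathbf{v}^T\mathbf{z}=\lambda_{\max}(A(\mathbf{v}))$. *)

theory Defs
  imports "HOL-Analysis.Analysis"
begin

definition sym_matrices :: "(real^'n^'n) set" where
  "sym_matrices = {X. transpose X = X}"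

definition psd :: "real^'n^'n \<Rightarrow> bool" where
  "psd X \<longleftrightarrow> X \<in> sym_matrices \<and> (\<forall>x. 0 \<le> x \<bullet> (X *v x))"

definition spectraplex :: "(real^'n^'n) set" where
  "spectraplex = {X. psd X \<and> trace X = 1}"

definition eigenvalues :: "real^'n^'n \<Rightarrow> real set" where
  "eigenvalues X = {c. \<exists>x. x \<noteq> 0 \<and> X *v x = c *\<^sub>R x}"

text \<open>Only meaningful for symmetric matrices, whose set of real
  eigenvalues is finite and nonempty.\<close>

definition lambda_max :: "real^'n^'n \<Rightarrow> real" where
  "lambda_max X = Max (eigenvalues X)"

text \<open>The product that \<^class>\<open>times\<close> provides on vectors is componentwise, so neither
  \<^const>\<open>power\<close> nor \<^const>\<open>exp\<close> is usable for matrices.\<close>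

primrec matrix_power :: "real^'n^'n \<Rightarrow> nat \<Rightarrow> real^'n^'n" where
  "matrix_power X 0 = mat 1"
| "matrix_power X (Suc k) = X ** matrix_power X k"

definition matrix_exp :: "real^'n^'n \<Rightarrow> real^'n^'n" where
  "matrix_exp X = (\<Sum>k. matrix_power X k /\<^sub>R fact k)"

definition pencil :: "('m::finite \<Rightarrow> real^'n^'n) \<Rightarrow> real^'m \<Rightarrow> real^'n^'n" where
  "pencil A y = (\<Sum>i\<in>UNIV. y $ i *\<^sub>R A i)"

definition moment_map :: "('m::finite \<Rightarrow> real^'n^'n) \<Rightarrow> real^'n^'n \<Rightarrow> real^'m" where
  "moment_map A X = (\<chi> i. trace (A i ** X))"

definition moment_body :: "('m::finite \<Rightarrow> real^'n^'n) \<Rightarrow> (real^'m) set" where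
  "moment_body A = moment_map A ` spectraplex"

definition dual_objective ::
    "('m::finite \<Rightarrow> real^'n^'n) \<Rightarrow> real^'m \<Rightarrow> real^'m \<Rightarrow> real" where
  "dual_objective A b y = ln (trace (matrix_exp (pencil A y))) - b \<bullet> y"

definition gradient :: "('a::euclidean_space \<Rightarrow> real) \<Rightarrow> 'a \<Rightarrow> 'a" where
  "gradient f x = (THE D. GDERIV f x :> D)"

lemma gradient_eq:
  assumes "GDERIV f x :> D"
  shows "gradient f x = D"
  unfolding gradient_def
proof (rule the_equality)
  show "GDERIV f x :> D" by (rule assms)
next
  fix D' assume "GDERIV f x :> D'"
  then have "(\<lambda>h. h \<bullet> D') = (\<lambda>h. h \<bullet> D)"
    using assms unfolding gderiv_def by (rule has_derivative_unique)
  then have "\<And>h. h \<bullet> D' = h \<bullet> D" by metis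
  then show "D' = D" by (metis vector_eq_rdot inner_commute)
qed

definition gradient_iterates ::
    "('a::euclidean_space \<Rightarrow> real) \<Rightarrow> real \<Rightarrow> (nat \<Rightarrow> 'a) \<Rightarrow> bool" where
  "gradient_iterates f s y \<longleftrightarrow> (\<forall>k. y (Suc k) = y k - s *\<^sub>R gradient f (y k))"

end

theory Submission
  imports Defs
begin

text \<open>
  The proof compares two functions of \<open>y\<close>: the support function
  \<open>\<lambda>\<^sub>m\<^sub>a\<^sub>x (A(y))\<close> of the moment body, and its smooth majorant \<open>log tr exp A(y)\<close>.
  Writing the trace of the exponential as the sum of \<open>exp \<lambda>\<close> over the \<open>n\<close> eigenvalues
  \<open>\<lambda>\<close> of a symmetric matrix \<open>X\<close>, and keeping only the largest term or replacing every
  term by it, gives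
  \<open>\<lambda>\<^sub>m\<^sub>a\<^sub>x X \<le> log tr exp X \<le> log n + \<lambda>\<^sub>m\<^sub>a\<^sub>x X\<close>
  (\<open>lambda_max_le_ln_trace_exp\<close>, \<open>ln_trace_exp_scaleR_le\<close>).

  The lower bound settles everything that assumes \<open>f(y) < 0\<close>: then
  \<open>\<lambda>\<^sub>m\<^sub>a\<^sub>x (A(y)) < b\<^sup>T y\<close>, whereas \<open>y\<^sup>T z \<le> \<lambda>\<^sub>m\<^sub>a\<^sub>x (A(y))\<close> on the moment body
  (\<open>inner_moment_body_le\<close>), so \<open>y\<close> separates \<open>b\<close> from the body. For an iterate of the
  gradient method this is a certificate of infeasibility.

  For the converse, a point \<open>b\<close> outside the moment body is separated from it by some \<open>v\<close>
  with \<open>\<lambda>\<^sub>m\<^sub>a\<^sub>x (A(v)) < b\<^sup>T v\<close> (\<open>ex_lambda_max_less_if_notin_moment_body\<close>). The gap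
  between the two sides grows linearly along the ray \<open>t v\<close>, while the upper bound exceeds
  \<open>\<lambda>\<^sub>m\<^sub>a\<^sub>x\<close> only by the constant \<open>log n\<close>; hence \<open>f(t v) < 0\<close> for large \<open>t\<close>
  (\<open>ex_dual_objective_neg\<close>).

  Both bounds and the support inequality rest on the spectral decomposition
  \<open>X = \<Sum> l(e) e e\<^sup>T\<close> over an orthonormal eigenbasis. It is derived from the fact that a
  maximiser of the quadratic form \<open>x\<^sup>T X x\<close> on the unit sphere of an invariant subspace is an
  eigenvector.
\<close>

section \<open>Symmetric matrices and rank-one projections\<close>

lemma sym_matrices_inner_commute:
  fixes X :: "real^'n^'n"
  assumes "X \<in> sym_matrices"
  shows "x \<bullet> (X *v y) = (X *v x) \<bullet> y"
proof -
  have "x v* X = X *v x"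
    using assms transpose_matrix_vector[of X x] by (simp add: sym_matrices_def)
  then show ?thesis using dot_lmul_matrix[of x X y] by simp
qed

lemma sym_matrices_scaleR: "X \<in> sym_matrices \<Longrightarrow> c *\<^sub>R X \<in> sym_matrices"
  by (simp add: sym_matrices_def transpose_scalar)

lemma sym_matrices_add: "X \<in> sym_matrices \<Longrightarrow> Y \<in> sym_matrices \<Longrightarrow> X + Y \<in> sym_matrices"
  by (simp add: sym_matrices_def transpose_def vec_eq_iff)

lemma sym_matrices_sum: "(\<And>i. i \<in> I \<Longrightarrow> F i \<in> sym_matrices) \<Longrightarrow> sum F I \<in> sym_matrices"
proof (induction I rule: infinite_finite_induct)
  case (insert i I)
  then show ?case by (simp add: sym_matrices_add)
qed (simp_all add: sym_matrices_def transpose_def vec_eq_iff)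

lemma trace_scaleR: "trace (c *\<^sub>R (X :: real^'n^'n)) = c * trace X"
  by (simp add: trace_def sum_distrib_left)

lemma trace_sum: "trace (sum F I :: real^'n^'n) = (\<Sum>i\<in>I. trace (F i))"
  unfolding trace_def by (simp add: sum.swap[of _ I])

lemma sum_matrix_mult: "sum F I ** (Y :: real^'n^'n) = (\<Sum>i\<in>I. F i ** Y)"
  by (simp add: matrix_matrix_mult_def vec_eq_iff sum_distrib_right sum.swap[of _ I])

lemma sum_matrix_vector_mult: "sum F I *v (x :: real^'n) = (\<Sum>i\<in>I. F i *v x)"
  by (induction I rule: infinite_finite_induct) (simp_all add: matrix_vector_mult_add_rdistrib)

definition outer :: "real^'n \<Rightarrow> real^'n^'n" where
  "outer x = (\<chi> i j. x $ i * x $ j)"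

lemma outer_mult_vector: "outer x *v y = (y \<bullet> x) *\<^sub>R x"
  by (simp add: outer_def matrix_vector_mult_def vec_eq_iff inner_vec_def sum_distrib_left ac_simps)

lemma matrix_mult_outer_eigenvector:
  assumes "X *v x = c *\<^sub>R x"
  shows "X ** outer x = c *\<^sub>R outer x"
proof -
  have "(X ** outer x) *v y = (c *\<^sub>R outer x) *v y" for y
    by (simp add: assms outer_mult_vector matrix_vector_mul_assoc[symmetric]
        matrix_scaleR_vector_ac scaleR_matrix_vector_assoc[symmetric])
  then show ?thesis by (simp add: matrix_eq)
qed

lemma trace_outer_mult: "trace (outer x ** Y) = x \<bullet> (Y *v x)"
proof -
  have "trace (outer x ** Y) = (\<Sum>i\<in>UNIV. \<Sum>k\<in>UNIV. x $ k * (Y $ k $ i * x $ i))"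
    by (simp add: outer_def trace_def matrix_matrix_mult_def ac_simps)
  also have "\<dots> = (\<Sum>k\<in>UNIV. \<Sum>i\<in>UNIV. x $ k * (Y $ k $ i * x $ i))"
    by (rule sum.swap)
  also have "\<dots> = x \<bullet> (Y *v x)"
    by (simp add: inner_vec_def matrix_vector_mult_def sum_distrib_left)
  finally show ?thesis .
qed

lemma trace_outer: "trace (outer x) = (norm x)\<^sup>2"
  using trace_outer_mult[of x "mat 1"] by (simp add: power2_norm_eq_inner)

section \<open>The spectral theorem\<close>

text \<open>
  Let \<open>u\<close> maximise the quadratic form of \<open>X\<close> on the unit sphere of \<open>S\<close>, with maximum
  \<open>c\<close>. Then \<open>g(x) = c |x|\<^sup>2 - x\<^sup>T X x\<close> is nonnegative on \<open>S\<close> and vanishes at \<open>u\<close>, so its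
  first-order variation at \<open>u\<close> must vanish in every direction of \<open>S\<close>. The invariance of
  \<open>S\<close> makes the residual \<open>w = X u - c u\<close> such a direction, and the variation along it is
  \<open>-2 |w|\<^sup>2\<close>.
\<close>
lemma symmetric_eigenvector_in_invariant_subspace:
  fixes X :: "real^'n^'n"
  assumes X: "X \<in> sym_matrices" and S: "subspace S" "S \<noteq> {0}"
    and inv: "\<And>x. x \<in> S \<Longrightarrow> X *v x \<in> S"
  obtains u c where "u \<in> S" "norm u = 1" "X *v u = c *\<^sub>R u"
proof -
  let ?q = "\<lambda>x. x \<bullet> (X *v x)"
  have "compact (sphere 0 1 \<inter> S)"
    using closed_subspace[OF S(1)] by (intro compact_Int_closed) auto
  moreover obtain a where "a \<in> S" "a \<noteq> 0"
    using S subspace_0 by blast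
  then have "a /\<^sub>R norm a \<in> sphere 0 1 \<inter> S"
    using S(1) by (simp add: subspace_scale)
  then have "sphere 0 1 \<inter> S \<noteq> {}" by blast
  moreover have "continuous_on (sphere 0 1 \<inter> S) ?q"
    by (intro continuous_intros matrix_vector_mult_linear_continuous_on)
  ultimately obtain u where u: "u \<in> sphere 0 1 \<inter> S"
    and umax: "\<And>x. x \<in> sphere 0 1 \<inter> S \<Longrightarrow> ?q x \<le> ?q u"
    using continuous_attains_sup[of "sphere 0 1 \<inter> S" ?q] by blast
  define c where "c = ?q u"
  define g where "g x = c * (x \<bullet> x) - ?q x" for x
  have g_nonneg: "0 \<le> g x" if "x \<in> S" for x
  proof (cases "x = 0")
    case False
    have "?q (x /\<^sub>R norm x) \<le> c"
      unfolding c_def using that False S(1) by (intro umax) (simp add: subspace_scale)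
    moreover have "?q (x /\<^sub>R norm x) = ?q x / (norm x)\<^sup>2"
      by (simp add: matrix_vector_mult_scaleR power2_eq_square divide_inverse)
    ultimately show ?thesis
      using False by (simp add: g_def pos_divide_le_eq power2_norm_eq_inner[symmetric])
  qed (simp add: g_def)
  have uu: "u \<bullet> u = 1" using u by (simp add: norm_eq_1)
  define w where "w = X *v u - c *\<^sub>R u"
  have wS: "w \<in> S" using u S(1) inv by (simp add: w_def subspace_diff subspace_scale)
  have expand: "g (u + t *\<^sub>R w) = t\<^sup>2 * g w - 2 * t * (w \<bullet> w)" for t
  proof -
    have "X *v u = w + c *\<^sub>R u" by (simp add: w_def)
    then have "u \<bullet> (X *v w) = w \<bullet> w + c * (u \<bullet> w)"
      "w \<bullet> (X *v u) = w \<bullet> w + c * (u \<bullet> w)"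
      using sym_matrices_inner_commute[OF X, of u w]
      by (simp_all add: inner_simps inner_commute)
    moreover have "?q u = c" by (simp add: c_def)
    ultimately show ?thesis
      by (simp add: g_def matrix_vector_right_distrib matrix_vector_mult_scaleR
          inner_simps inner_commute[of w u] uu power2_eq_square algebra_simps)
  qed
  have nonneg: "0 \<le> t\<^sup>2 * g w - 2 * t * (w \<bullet> w)" for t
    unfolding expand[symmetric] using u wS S(1)
    by (intro g_nonneg) (simp add: subspace_add subspace_scale)
  have "w \<bullet> w = 0"
  proof (rule ccontr)
    assume "w \<bullet> w \<noteq> 0"
    then have pos: "w \<bullet> w > 0" using inner_ge_zero[of w] by linarith
    show False
    proof (cases "g w = 0")
      case True
      then show False using nonneg[of 1] pos by simp
    next
      case False
      then have "g w > 0" using g_nonneg[OF wS] by simp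
      \<comment> \<open>The choice \<open>t = |w|\<^sup>2 / g(w)\<close> minimises the quadratic in \<open>t\<close>.\<close>
      then have "((w \<bullet> w) / g w)\<^sup>2 * g w - 2 * ((w \<bullet> w) / g w) * (w \<bullet> w) = - ((w \<bullet> w)\<^sup>2 / g w)"
        by (simp add: power2_eq_square field_simps)
      moreover have "(w \<bullet> w)\<^sup>2 / g w > 0" using \<open>g w > 0\<close> pos by (intro divide_pos_pos zero_less_power)
      ultimately show False using nonneg[of "(w \<bullet> w) / g w"] by linarith
    qed
  qed
  then have "X *v u = c *\<^sub>R u" by (simp add: w_def)
  with u that show ?thesis by auto
qed

text \<open>
  The function \<open>l\<close> assigns eigenvalues to basis vectors; its values repeat according to
  multiplicity, which is what the trace of a matrix function has to count.
\<close>
definition eigenbasis :: "real^'n^'n \<Rightarrow> (real^'n) set \<Rightarrow> (real^'n \<Rightarrow> real) \<Rightarrow> bool" where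
  "eigenbasis X B l \<longleftrightarrow> finite B \<and> pairwise orthogonal B \<and> span B = UNIV \<and>
     (\<forall>e\<in>B. norm e = 1 \<and> X *v e = l e *\<^sub>R e)"

text \<open>
  Take an orthonormal set of eigenvectors of greatest cardinality. The vectors orthogonal to it
  form a subspace that the symmetric matrix maps to itself; if this subspace were nonzero, it
  would contain a further unit eigenvector.
\<close>
lemma ex_eigenbasis:
  fixes X :: "real^'n^'n"
  assumes X: "X \<in> sym_matrices"
  obtains B l where "eigenbasis X B l"
proof -
  define P where "P B \<longleftrightarrow> pairwise orthogonal B \<and>
    (\<forall>e\<in>B. norm e = 1 \<and> (\<exists>c. X *v e = c *\<^sub>R e))" for B :: "(real^'n) set"
  have fin: "finite B \<and> card B \<le> DIM(real^'n)" if "P B" for B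
  proof -
    have "pairwise orthogonal B" "\<forall>e\<in>B. norm e = 1" using that unfolding P_def by blast+
    moreover from this have "0 \<notin> B" by force
    ultimately have "independent B" by (intro pairwise_orthogonal_independent)
    then show ?thesis using independent_bound by blast
  qed
  have "P {}" by (simp add: P_def)
  then have "\<exists>B. P B \<and> (\<forall>C. P C \<longrightarrow> card C \<le> card B)"
    using fin by (intro ex_has_greatest_nat[where b = "Suc DIM(real^'n)"]) (auto simp: less_Suc_eq_le)
  then obtain B where B: "P B" and Bmax: "\<And>C. P C \<Longrightarrow> card C \<le> card B"
    by blast
  have "span B = UNIV"
  proof (rule ccontr)
    assume "span B \<noteq> UNIV"
    then obtain a where a: "a \<noteq> 0" "\<And>x. x \<in> span B \<Longrightarrow> a \<bullet> x = 0"
      using span_not_UNIV_orthogonal by blast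
    define S where "S = {y. \<forall>x\<in>B. orthogonal x y}"
    have "a \<in> S" using a by (auto simp: S_def orthogonal_def inner_commute span_base)
    then have "S \<noteq> {0}" using a(1) by blast
    moreover have "subspace S" unfolding S_def by (rule subspace_orthogonal_to_vectors)
    moreover have "X *v y \<in> S" if y: "y \<in> S" for y
      unfolding S_def
    proof safe
      fix x assume x: "x \<in> B"
      then obtain c where c: "X *v x = c *\<^sub>R x" using B by (auto simp: P_def)
      have "x \<bullet> (X *v y) = c * (x \<bullet> y)"
        by (simp add: sym_matrices_inner_commute[OF X] c)
      then show "orthogonal x (X *v y)" using x y by (simp add: S_def orthogonal_def)
    qed
    ultimately obtain u c where u: "u \<in> S" "norm u = 1" "X *v u = c *\<^sub>R u"
      using symmetric_eigenvector_in_invariant_subspace[OF X, of S] by blast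
    have uB: "orthogonal u x" if "x \<in> B" for x
      using u(1) that by (simp add: S_def orthogonal_commute[of u])
    have "P (insert u B)"
      unfolding P_def
    proof (intro conjI)
      show "pairwise orthogonal (insert u B)"
        using B uB unfolding P_def by (intro pairwise_orthogonal_insert) blast+
      show "\<forall>e\<in>insert u B. norm e = 1 \<and> (\<exists>c. X *v e = c *\<^sub>R e)"
        using B u unfolding P_def by blast
    qed
    moreover have "u \<notin> B" using uB[of u] u(2) by (auto simp: orthogonal_def)
    ultimately show False using Bmax[of "insert u B"] fin[OF B] by simp
  qed
  moreover have "\<exists>l. \<forall>e\<in>B. X *v e = l e *\<^sub>R e"
    using B unfolding P_def by (intro bchoice) blast
  then obtain l where "\<forall>e\<in>B. X *v e = l e *\<^sub>R e" by blast
  ultimately have "eigenbasis X B l" using B fin[OF B] by (simp add: eigenbasis_def P_def)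
  then show ?thesis by (rule that)
qed

lemma eigenbasis_expand:
  assumes "eigenbasis X B l"
  shows "(\<Sum>e\<in>B. (x \<bullet> e) *\<^sub>R e) = x"
  using assms by (intro orthonormal_basis_expand) (auto simp: eigenbasis_def)

lemma eigenbasis_resolution_of_identity:
  assumes "eigenbasis X B l"
  shows "mat 1 = (\<Sum>e\<in>B. outer e)"
  using eigenbasis_expand[OF assms]
  by (simp add: matrix_eq sum_matrix_vector_mult outer_mult_vector)

lemma matrix_power_eigenbasis:
  assumes "eigenbasis X B l"
  shows "matrix_power X k = (\<Sum>e\<in>B. l e ^ k *\<^sub>R outer e)"
proof (induction k)
  case 0
  then show ?case by (simp add: eigenbasis_resolution_of_identity[OF assms])
next
  case (Suc k)
  have "X ** (\<Sum>e\<in>B. l e ^ k *\<^sub>R outer e) = (\<Sum>e\<in>B. l e ^ k *\<^sub>R (X ** outer e))"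
    by (induction B rule: infinite_finite_induct)
      (simp_all add: matrix_add_ldistrib matrix_scalar_ac scalar_matrix_assoc)
  also have "\<dots> = (\<Sum>e\<in>B. l e ^ Suc k *\<^sub>R outer e)"
  proof (rule sum.cong)
    fix e assume "e \<in> B"
    then have "X ** outer e = l e *\<^sub>R outer e"
      using assms by (intro matrix_mult_outer_eigenvector) (simp add: eigenbasis_def)
    then show "l e ^ k *\<^sub>R (X ** outer e) = l e ^ Suc k *\<^sub>R outer e" by simp
  qed simp
  finally show ?case using Suc by simp
qed

lemma eigenbasis_spectral_decomposition:
  assumes "eigenbasis X B l"
  shows "X = (\<Sum>e\<in>B. l e *\<^sub>R outer e)"
  using matrix_power_eigenbasis[OF assms, of 1] by simp

lemma eigenbasis_card:
  fixes X :: "real^'n^'n"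
  assumes "eigenbasis X B l"
  shows "card B = CARD('n)"
proof -
  have "real (card B) = (\<Sum>e\<in>B. trace (outer e))"
    using assms by (simp add: trace_outer eigenbasis_def)
  also have "\<dots> = trace (mat 1 :: real^'n^'n)"
    by (simp add: eigenbasis_resolution_of_identity[OF assms] trace_sum)
  finally show ?thesis by (simp add: trace_I)
qed

lemma eigenbasis_nonempty: "eigenbasis X B l \<Longrightarrow> finite B \<and> B \<noteq> {}"
  using eigenbasis_card by (auto simp: eigenbasis_def)

section \<open>The trace exponential and the largest eigenvalue\<close>

text \<open>
  By the spectral decomposition of the powers, the matrix series is a finite sum of scalar
  exponential series, so its convergence needs no separate norm estimate.
\<close>
lemma trace_matrix_exp:
  assumes "eigenbasis X B l"
  shows "trace (matrix_exp X) = (\<Sum>e\<in>B. exp (l e))"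
proof -
  have "(\<lambda>k. \<Sum>e\<in>B. (l e ^ k /\<^sub>R fact k) *\<^sub>R outer e) sums (\<Sum>e\<in>B. exp (l e) *\<^sub>R outer e)"
    by (intro sums_sum sums_scaleR_left exp_converges)
  moreover have "(\<Sum>e\<in>B. (l e ^ k /\<^sub>R fact k) *\<^sub>R outer e) = matrix_power X k /\<^sub>R fact k" for k
    by (simp add: matrix_power_eigenbasis[OF assms] scaleR_sum_right)
  ultimately have "matrix_exp X = (\<Sum>e\<in>B. exp (l e) *\<^sub>R outer e)"
    by (simp add: matrix_exp_def sums_iff)
  then show ?thesis
    using assms by (simp add: trace_sum trace_scaleR trace_outer eigenbasis_def)
qed

lemma eigenvalues_eigenbasis:
  assumes B: "eigenbasis X B l"
  shows "eigenvalues X = l ` B"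
proof (intro equalityI subsetI)
  fix c assume "c \<in> eigenvalues X"
  then obtain x where x: "x \<noteq> 0" "X *v x = c *\<^sub>R x" by (auto simp: eigenvalues_def)
  \<comment> \<open>Comparing the components of \<open>X x\<close> and \<open>c x\<close> along such an \<open>e\<close> gives \<open>c = l(e)\<close>.\<close>
  have "\<exists>e\<in>B. x \<bullet> e \<noteq> 0"
  proof (rule ccontr)
    assume "\<not> ?thesis"
    then have "(\<Sum>e\<in>B. (x \<bullet> e) *\<^sub>R e) = 0" by (intro sum.neutral) simp
    with eigenbasis_expand[OF B, of x] x(1) show False by simp
  qed
  then obtain e where e: "e \<in> B" "x \<bullet> e \<noteq> 0" by blast
  have "(X *v x) \<bullet> e = (\<Sum>d\<in>B. l d * (x \<bullet> d) * (d \<bullet> e))"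
    by (subst eigenbasis_spectral_decomposition[OF B])
      (simp add: sum_matrix_vector_mult scaleR_matrix_vector_assoc[symmetric] outer_mult_vector
        inner_sum_left mult.assoc)
  also have "\<dots> = (\<Sum>d\<in>B. if d = e then l e * (x \<bullet> e) else 0)"
    using B e(1) by (intro sum.cong)
      (auto simp: eigenbasis_def pairwise_def orthogonal_def norm_eq_1)
  also have "\<dots> = l e * (x \<bullet> e)" using e(1) eigenbasis_nonempty[OF B] by simp
  finally have "c = l e" using x(2) e(2) by simp
  then show "c \<in> l ` B" using e(1) by blast
next
  fix c assume "c \<in> l ` B"
  then obtain e where "e \<in> B" "c = l e" by blast
  with B have "e \<noteq> 0" "X *v e = c *\<^sub>R e" by (auto simp: eigenbasis_def)
  then show "c \<in> eigenvalues X" by (auto simp: eigenvalues_def)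
qed

lemma lambda_max_eigenbasis: "eigenbasis X B l \<Longrightarrow> lambda_max X = Max (l ` B)"
  by (simp add: lambda_max_def eigenvalues_eigenbasis)

lemma lambda_max_attained:
  assumes "X \<in> sym_matrices"
  obtains u where "norm u = 1" "u \<bullet> (X *v u) = lambda_max X"
proof -
  obtain B l where B: "eigenbasis X B l" by (rule ex_eigenbasis[OF assms])
  have "lambda_max X \<in> l ` B"
    using eigenbasis_nonempty[OF B] by (simp add: lambda_max_eigenbasis[OF B])
  then obtain e where "e \<in> B" "lambda_max X = l e" by blast
  with B that[of e] show ?thesis by (auto simp: eigenbasis_def norm_eq_1)
qed

text \<open>
  In an eigenbasis of \<open>X\<close> the trace of \<open>X Y\<close> is the sum of \<open>l(e) e\<^sup>T Y e\<close>, a combination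
  of eigenvalues with nonnegative weights of total mass \<open>tr Y\<close>. Only \<open>X\<close> has to be
  diagonalised.
\<close>
lemma trace_mult_psd_le_lambda_max:
  assumes X: "X \<in> sym_matrices" and Y: "psd Y"
  shows "trace (X ** Y) \<le> lambda_max X * trace Y"
proof -
  obtain B l where B: "eigenbasis X B l" by (rule ex_eigenbasis[OF X])
  have "trace (X ** Y) = (\<Sum>e\<in>B. l e * (e \<bullet> (Y *v e)))"
    by (subst eigenbasis_spectral_decomposition[OF B])
      (simp add: sum_matrix_mult trace_sum trace_scaleR trace_outer_mult
        scalar_matrix_assoc[symmetric])
  also have "\<dots> \<le> (\<Sum>e\<in>B. lambda_max X * (e \<bullet> (Y *v e)))"
    using Y eigenbasis_nonempty[OF B]
    by (intro sum_mono mult_right_mono) (auto simp: psd_def lambda_max_eigenbasis[OF B])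
  also have "\<dots> = lambda_max X * trace (mat 1 ** Y)"
    by (simp add: eigenbasis_resolution_of_identity[OF B] sum_matrix_mult trace_sum
        trace_outer_mult sum_distrib_left del: matrix_mul_lid)
  finally show ?thesis by simp
qed

lemma lambda_max_le_ln_trace_exp:
  assumes "X \<in> sym_matrices"
  shows "lambda_max X \<le> ln (trace (matrix_exp X))"
proof -
  obtain B l where B: "eigenbasis X B l" by (rule ex_eigenbasis[OF assms])
  have "lambda_max X \<in> l ` B"
    using eigenbasis_nonempty[OF B] by (simp add: lambda_max_eigenbasis[OF B])
  then obtain e where e: "e \<in> B" "lambda_max X = l e" by blast
  have "exp (l e) \<le> trace (matrix_exp X)"
    unfolding trace_matrix_exp[OF B]
    using e(1) eigenbasis_nonempty[OF B] by (intro member_le_sum) auto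
  then show ?thesis
    using ln_le_cancel_iff[of "exp (l e)" "trace (matrix_exp X)"] e(2)
    by (simp add: less_le_trans[OF exp_gt_zero])
qed

text \<open>
  The scaling factor is part of the statement because an eigenbasis of \<open>X\<close> is also one of
  \<open>t X\<close>; the additive error \<open>log n\<close> does not depend on \<open>t\<close>.
\<close>
lemma ln_trace_exp_scaleR_le:
  fixes X :: "real^'n^'n"
  assumes "X \<in> sym_matrices" "t \<ge> 0"
  shows "ln (trace (matrix_exp (t *\<^sub>R X))) \<le> ln CARD('n) + t * lambda_max X"
proof -
  obtain B l where B: "eigenbasis X B l" by (rule ex_eigenbasis[OF assms(1)])
  then have tB: "eigenbasis (t *\<^sub>R X) B (\<lambda>e. t * l e)"
    by (auto simp: eigenbasis_def scaleR_matrix_vector_assoc[symmetric])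
  have "(\<Sum>e\<in>B. exp (t * l e)) \<le> (\<Sum>e\<in>B. exp (t * lambda_max X))"
    using assms(2) eigenbasis_nonempty[OF B]
    by (intro sum_mono) (auto simp: lambda_max_eigenbasis[OF B] intro!: mult_left_mono)
  then have "trace (matrix_exp (t *\<^sub>R X)) \<le> CARD('n) * exp (t * lambda_max X)"
    by (simp add: trace_matrix_exp[OF tB] eigenbasis_card[OF B])
  moreover have "0 < trace (matrix_exp (t *\<^sub>R X))"
    unfolding trace_matrix_exp[OF tB] using eigenbasis_nonempty[OF B] by (intro sum_pos) auto
  ultimately have "ln (trace (matrix_exp (t *\<^sub>R X))) \<le> ln (CARD('n) * exp (t * lambda_max X))"
    by (subst ln_le_cancel_iff) auto
  then show ?thesis by (simp add: ln_mult)
qed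

section \<open>The moment body\<close>

lemma pencil_sym: "(\<And>i. A i \<in> sym_matrices) \<Longrightarrow> pencil A y \<in> sym_matrices"
  by (simp add: pencil_def sym_matrices_sum sym_matrices_scaleR)

lemma pencil_scaleR: "pencil A (t *\<^sub>R y) = t *\<^sub>R pencil A y"
  by (simp add: pencil_def scaleR_sum_right)

lemma inner_moment_map: "y \<bullet> moment_map A X = trace (pencil A y ** X)"
  by (simp add: inner_vec_def moment_map_def pencil_def sum_matrix_mult trace_sum trace_scaleR
      scalar_matrix_assoc[symmetric])

lemma inner_moment_body_le:
  assumes "\<And>i. A i \<in> sym_matrices" "z \<in> moment_body A"
  shows "y \<bullet> z \<le> lambda_max (pencil A y)"
proof -
  obtain X where "psd X" "trace X = 1" "z = moment_map A X"
    using assms(2) by (auto simp: moment_body_def spectraplex_def)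
  then show ?thesis
    using trace_mult_psd_le_lambda_max[OF pencil_sym[of A y, OF assms(1)], of X]
    by (simp add: inner_moment_map)
qed

lemma linear_moment_map: "linear (moment_map A)"
proof (rule linearI)
  fix X Y show "moment_map A (X + Y) = moment_map A X + moment_map A Y"
    by (simp add: moment_map_def vec_eq_iff matrix_add_ldistrib trace_add)
next
  fix c X show "moment_map A (c *\<^sub>R X) = c *\<^sub>R moment_map A X"
    by (simp add: moment_map_def vec_eq_iff matrix_scalar_ac
        scalar_matrix_assoc[symmetric] trace_scaleR)
qed

lemma convex_hull_outer_subset_spectraplex: "convex hull (outer ` sphere 0 1) \<subseteq> spectraplex"
proof (rule hull_minimal)
  have "psd (outer x)" for x :: "real^'n"
    by (auto simp: psd_def sym_matrices_def transpose_def outer_def vec_eq_iff mult.commute)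
      (auto simp: outer_mult_vector inner_commute simp flip: outer_def)
  then show "outer ` sphere 0 1 \<subseteq> (spectraplex :: (real^'n^'n) set)"
    by (auto simp: spectraplex_def trace_outer)
next
  show "convex (spectraplex :: (real^'n^'n) set)"
    by (auto simp: convex_def spectraplex_def psd_def trace_add trace_scaleR sym_matrices_add
        sym_matrices_scaleR matrix_vector_mult_add_rdistrib inner_simps
        scaleR_matrix_vector_assoc[symmetric])
qed

text \<open>
  Instead of the moment body itself, the proof separates \<open>b\<close> from the image of the convex hull
  of the projections \<open>x x\<^sup>T\<close> with \<open>|x| = 1\<close>. This set is compact for general reasons,
  lies inside the moment body, and is large enough: the projection onto a leading eigenvector of
  \<open>A(v)\<close> attains \<open>\<lambda>\<^sub>m\<^sub>a\<^sub>x (A(v))\<close>.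
\<close>
lemma ex_lambda_max_less_if_notin_moment_body:
  fixes A :: "'m::finite \<Rightarrow> real^'n^'n"
  assumes A: "\<And>i. A i \<in> sym_matrices" and b: "b \<notin> moment_body A"
  obtains v where "lambda_max (pencil A v) < b \<bullet> v"
proof -
  let ?K = "moment_map A ` (convex hull (outer ` sphere 0 1))"
  have "b \<notin> ?K"
    using b convex_hull_outer_subset_spectraplex by (auto simp: moment_body_def)
  moreover have "convex ?K"
    by (intro convex_linear_image linear_moment_map convex_convex_hull)
  moreover have "continuous_on (sphere 0 1) outer"
    unfolding outer_def by (intro continuous_intros)
  then have "compact ?K"
    using linear_continuous_on[OF linear_moment_map[THEN linear_conv_bounded_linear[THEN iffD1]]]
    by (intro compact_continuous_image compact_convex_hull) auto
  ultimately obtain w \<beta> where w: "w \<bullet> b < \<beta>" "\<And>x. x \<in> ?K \<Longrightarrow> w \<bullet> x > \<beta>"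
    using separating_hyperplane_closed_point[of ?K b] compact_imp_closed by blast
  \<comment> \<open>The separating functional \<open>w\<close> is smaller at \<open>b\<close>, hence the change of sign.\<close>
  define v where "v = - w"
  obtain u where u: "norm u = 1" "u \<bullet> (pencil A v *v u) = lambda_max (pencil A v)"
    by (rule lambda_max_attained[OF pencil_sym[OF A]])
  have "v \<bullet> moment_map A (outer u) = lambda_max (pencil A v)"
    using u(2) by (simp add: inner_moment_map trace_mul_sym[of _ "outer u"] trace_outer_mult)
  moreover have "moment_map A (outer u) \<in> ?K"
    using u(1) by (auto intro!: hull_inc)
  ultimately have "lambda_max (pencil A v) < b \<bullet> v"
    using w(1) w(2)[of "moment_map A (outer u)"] by (simp add: v_def inner_commute[of b])
  then show ?thesis by (rule that)
qed

lemma ex_dual_objective_neg: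
  fixes A :: "'m::finite \<Rightarrow> real^'n^'n"
  assumes A: "\<And>i. A i \<in> sym_matrices" and v: "lambda_max (pencil A v) < b \<bullet> v"
  shows "\<exists>y. dual_objective A b y < 0"
proof -
  define d where "d = b \<bullet> v - lambda_max (pencil A v)"
  \<comment> \<open>With this \<open>t\<close> the bound \<open>log n - t d\<close> for the dual objective at \<open>t v\<close> equals \<open>-1\<close>.\<close>
  define t where "t = (ln CARD('n) + 1) / d"
  have "d > 0" using v by (simp add: d_def)
  then have "t \<ge> 0" and td: "t * d = ln CARD('n) + 1" by (simp_all add: t_def)
  have "dual_objective A b (t *\<^sub>R v) \<le> ln CARD('n) - t * d"
    using ln_trace_exp_scaleR_le[OF pencil_sym[of A v, OF A] \<open>t \<ge> 0\<close>]
    by (simp add: dual_objective_def pencil_scaleR d_def algebra_simps)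
  then show ?thesis using td by (intro exI[of _ "t *\<^sub>R v"]) simp
qed

theorem lemma13:
  fixes A :: "'m::finite \<Rightarrow> real^'n::finite^'n" and b :: "real^'m"
  assumes "CARD('n) \<ge> 2"
    and "\<And>i. A i \<in> sym_matrices"
    and "\<And>i. trace (A i) = 0"
    and "\<And>i j. trace (A i ** A j) = (if i = j then 1 else 0)"
  shows "(b \<in> moment_body A \<longleftrightarrow> (\<forall>y. dual_objective A b y \<ge> 0)) \<and>
    (\<forall>y k. gradient_iterates (dual_objective A b) 2 y \<and> dual_objective A b (y k) < 0 \<longrightarrow>
       b \<notin> moment_body A \<and>
       (\<forall>z \<in> moment_body A. y k \<bullet> z < b \<bullet> y k) \<and>
       lambda_max (pencil A (y k)) < b \<bullet> y k)"
proof -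
  note A = assms(2)
  have separates: "lambda_max (pencil A v) < b \<bullet> v \<and> (\<forall>z \<in> moment_body A. v \<bullet> z < b \<bullet> v)"
    if "dual_objective A b v < 0" for v
  proof -
    have "lambda_max (pencil A v) < b \<bullet> v"
      using that lambda_max_le_ln_trace_exp[OF pencil_sym[of A v, OF A]]
      by (simp add: dual_objective_def)
    then show ?thesis using inner_moment_body_le[of A _ v, OF A] by force
  qed
  then have notin: "b \<notin> moment_body A" if "dual_objective A b v < 0" for v
    using separates[OF that] by (auto simp: inner_commute)
  have "\<exists>y. dual_objective A b y < 0" if b: "b \<notin> moment_body A"
  proof -
    obtain v where "lambda_max (pencil A v) < b \<bullet> v"
      by (rule ex_lambda_max_less_if_notin_moment_body[OF A b])
    then show ?thesis by (rule ex_dual_objective_neg[OF A])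
  qed
  then show ?thesis using separates notin by (meson not_le)
qed

end
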